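(* Let $R$ be a nonzero $m\times m$ rational matrix function with no poles on $\mathbb{T}$ given by $R(z)=zC(I_n-zA)^{-1}\Gamma+R_0+\Gamma^*(zI_n-A^* )^{-1}C^*$ with $A$ stable $n\times n$, and assume $R(\zeta)\ge0$ for all $\zeta\in\mathbb{T}$. Let $\Phi\in\mathfrak{R}H^\infty_{r\times m}$ be an outer spectral factor of $R$, $\mathcal{X}_\Phi=\{x\in\mathbb{C}^n:W_{obs}x\in\operatorname{Im}T_\Phi^*\}$, and $C_\Phi$ an $r\times n$ matrix with $\Phi(z)=\Phi(0)+zC_\Phi(I_n-zA)^{-1}\Gamma$ and $W_{obs}x=T_\Phi^*W_{\Phi,obs}x$ for $x\in\mathcal{X}_\Phi$. Then the space \[ \mathcal{M}_\Phi=\{f\in\ell^2_+(\mathbb{C}^r): T_\Phi^*f\in\operatorname{Im}W_{obs}\} \] is given by $\mathcal{M}_\Phi=W_{\Phi,obs}\mathcal{X}_\Phi$. If, in addition, the pair $\{C,A\}$ is observable, then $\mathcal{M}_\Phi=\operatorname{Im}W_{\circ,obs}$, where $W_{\circ,obs}$ is the observability operator of the pair $\{C_\circ,A_\circ\}$ with $A_\circ=P_{\mathcal{X}_\Phi}A|_{\mathcal{X}_\Phi}$ and $C_\circ=C_\Phi|_{\mathcal{X}_\Phi}$.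
   Context: $\mathbb{T}$ is the unit circle; a stable matrix has all eigenvalues in the open unit disc. $\mathfrak{R}H^\infty_{k\times l}$: $k\times l$ rational matrix functions without poles in the closed unit disc. $\ell^2_+(\mathbb{C}^k)$: square summable $\mathbb{C}^k$-valued sequences indexed by $j\ge0$; $T_\Omega$: block Toeplitz operator with $(i,j)$ block $\Omega_{i-j}$. $W_{obs}=\operatorname{col}(CA^j)_{j\ge0}$, $W_{\Phi,obs}=\operatorname{col}(C_\Phi A^j)_{j\ge0}$. An outer spectral factor of $R$ is $\Phi\in\mathfrak{R}H^\infty_{r\times m}$ with $R(z)=\Phi(1/\bar z)^*\Phi(z)$ and $T_\Phi$ of dense range. Observable means the observability operator is injective. $P_{\mathcal{X}_\Phi}$ is the orthogonal projection onto $\mathcal{X}_\Phi$. (Such a $C_\Phi$ always exists.) *)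

theory Defs
  imports "HOL-Analysis.Analysis" "HOL-Computational_Algebra.Polynomial"
begin

(* Finite dimensions are type variables: C^n = complex^'n, an m x n matrix is complex^'n^'m. *)

definition mat_adj :: "complex^'n^'m \<Rightarrow> complex^'m^'n" where
  "mat_adj M = (\<chi> i j. cnj (M $ j $ i))"

(* Hermitian inner product on C^k *)
definition cinner :: "complex^'k \<Rightarrow> complex^'k \<Rightarrow> complex" where
  "cinner x y = (\<Sum>i\<in>UNIV. x $ i * cnj (y $ i))"

(* stable: all eigenvalues in the open unit disc *)
definition stable :: "complex^'n^'n \<Rightarrow> bool" where
  "stable A \<longleftrightarrow> (\<forall>c x. x \<noteq> 0 \<and> A *v x = c *s x \<longrightarrow> cmod c < 1)"

(* positive semidefinite matrix *)
definition psd :: "complex^'m^'m \<Rightarrow> bool" where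
  "psd M \<longleftrightarrow> mat_adj M = M \<and> (\<forall>x. 0 \<le> Re (cinner (M *v x) x))"

definition msc :: "complex \<Rightarrow> complex^'n^'m \<Rightarrow> complex^'n^'m" where
  "msc z M = (\<chi> i j. z * M $ i $ j)"

(* R(z) = z C (I - zA)^{-1} Gamma + R0 + adj(Gamma) (zI - adj A)^{-1} adj C *)
definition Rfun :: "complex^'n^'m \<Rightarrow> complex^'n^'n \<Rightarrow> complex^'m^'n \<Rightarrow> complex^'m^'m
    \<Rightarrow> complex \<Rightarrow> complex^'m^'m" where
  "Rfun C A \<Gamma> R0 z =
     msc z (C ** matrix_inv (mat 1 - msc z A) ** \<Gamma>) + R0
      + mat_adj \<Gamma> ** matrix_inv (msc z (mat 1) - mat_adj A) ** mat_adj C"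

(* the points where the realization formula of R is defined *)
definition Rdom :: "complex^'n^'n \<Rightarrow> complex \<Rightarrow> bool" where
  "Rdom A z \<longleftrightarrow> det (mat 1 - msc z A) \<noteq> 0 \<and> det (msc z (mat 1) - mat_adj A) \<noteq> 0"

(* Phi \<in> RH^\<infinity>_{r x m}: rational matrix function (each entry a quotient of polynomials)
   without poles in the closed unit disc *)
definition RH_inf :: "(complex \<Rightarrow> complex^'m^'r) \<Rightarrow> bool" where
  "RH_inf \<Phi> \<longleftrightarrow> (\<forall>i j. \<exists>p q. (\<forall>z. cmod z \<le> 1 \<longrightarrow> poly q z \<noteq> 0) \<and>
                              (\<forall>z. \<Phi> z $ i $ j = poly p z / poly q z))"

(* Taylor coefficients at 0 *)
definition taylor_coeff :: "(complex \<Rightarrow> complex^'m^'r) \<Rightarrow> nat \<Rightarrow> complex^'m^'r" where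
  "taylor_coeff \<Phi> k = (\<chi> i j. (deriv ^^ k) (\<lambda>z. \<Phi> z $ i $ j) 0 / of_nat (fact k))"

(* l^2_+(C^k) *)
definition l2 :: "(nat \<Rightarrow> complex^'k) set" where
  "l2 = {f. summable (\<lambda>j. (norm (f j))\<^sup>2)}"

definition l2inner :: "(nat \<Rightarrow> complex^'k) \<Rightarrow> (nat \<Rightarrow> complex^'k) \<Rightarrow> complex" where
  "l2inner f g = (\<Sum>j. cinner (f j) (g j))"

definition l2norm :: "(nat \<Rightarrow> complex^'k) \<Rightarrow> real" where
  "l2norm f = sqrt (\<Sum>j. (norm (f j))\<^sup>2)"

(* block Toeplitz operator T_Omega, (i,j) block Omega_{i-j} (zero for i<j) *)
definition toeplitz :: "(nat \<Rightarrow> complex^'m^'r) \<Rightarrow> (nat \<Rightarrow> complex^'m) \<Rightarrow> (nat \<Rightarrow> complex^'r)" where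
  "toeplitz \<Omega> f = (\<lambda>i. \<Sum>j\<le>i. \<Omega> (i - j) *v f j)"

(* Hilbert space adjoint of an operator l^2_+(C^m) -> l^2_+(C^r) *)
definition l2_adjoint :: "((nat \<Rightarrow> complex^'m) \<Rightarrow> (nat \<Rightarrow> complex^'r))
     \<Rightarrow> (nat \<Rightarrow> complex^'r) \<Rightarrow> (nat \<Rightarrow> complex^'m)" where
  "l2_adjoint T g = (THE h. h \<in> l2 \<and> (\<forall>f\<in>l2. l2inner (T f) g = l2inner f h))"

definition dense_range_l2 :: "((nat \<Rightarrow> complex^'m) \<Rightarrow> (nat \<Rightarrow> complex^'r)) \<Rightarrow> bool" where
  "dense_range_l2 T \<longleftrightarrow> (\<forall>g\<in>l2. \<forall>e>0. \<exists>f\<in>l2. l2norm (\<lambda>j. T f j - g j) < e)"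

(* outer spectral factor of R *)
definition outer_spectral_factor ::
  "(complex \<Rightarrow> complex^'m^'m) \<Rightarrow> (complex \<Rightarrow> bool) \<Rightarrow> (complex \<Rightarrow> complex^'m^'r) \<Rightarrow> bool" where
  "outer_spectral_factor R Rdef \<Phi> \<longleftrightarrow> RH_inf \<Phi> \<and>
     (\<forall>z. z \<noteq> 0 \<and> Rdef z \<and> (\<forall>i j. (\<lambda>w. \<Phi> w $ i $ j) analytic_on {z, 1 / cnj z})
          \<longrightarrow> R z = mat_adj (\<Phi> (1 / cnj z)) ** \<Phi> z) \<and>
     dense_range_l2 (toeplitz (taylor_coeff \<Phi>))"

(* observability operator of a pair {C, F}, F a linear map: x |-> (C F^j x)_{j>=0} *)
definition obs :: "complex^'n^'m \<Rightarrow> (complex^'n \<Rightarrow> complex^'n) \<Rightarrow> complex^'n \<Rightarrow> (nat \<Rightarrow> complex^'m)" where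
  "obs C F x = (\<lambda>j. C *v ((F ^^ j) x))"

(* orthogonal projection onto a subspace X of C^n *)
definition orth_proj :: "(complex^'n) set \<Rightarrow> complex^'n \<Rightarrow> complex^'n" where
  "orth_proj X x = (THE y. y \<in> X \<and> (\<forall>z\<in>X. cinner (x - y) z = 0))"

end

theory Submission
  imports Defs "HOL-Complex_Analysis.Complex_Analysis"
begin

text \<open>
  Because \<Phi> has no poles on the closed disc, its Taylor coefficients \<Phi>_k are absolutely
  summable. Hence T_\<Phi> is bounded on \<ell>2 and its Hilbert space adjoint is the explicit operator
  g \<mapsto> (\<Sum>_k \<Phi>_k^* g_(k+j))_j, which is injective because T_\<Phi> has dense range. Stability
  of A makes all observability sequences square summable. Now if T_\<Phi>^* f = W_obs x, then
  x \<in> X_\<Phi>, so T_\<Phi>^* f = W_obs x = T_\<Phi>^* W_\<Phi>,obs x and injectivity gives f = W_\<Phi>,obs x;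
  the reverse inclusion is the defining property of C_\<Phi>. Finally, the range of T_\<Phi>^* is
  closed under differences and under the backward shift, which W_obs intertwines with A, so
  X_\<Phi> is an A-invariant subspace: A_\<circ> is simply the restriction of A, and W_\<circ>,obs
  coincides with W_\<Phi>,obs on X_\<Phi>.
\<close>

unbundle no Formal_Power_Series.fps_syntax

section \<open>Inequalities for sums and series\<close>

lemma abs_summable_imp_square_summable:
  fixes a :: "nat \<Rightarrow> 'a::real_normed_vector"
  assumes "summable (\<lambda>n. norm (a n))"
  shows "summable (\<lambda>n. (norm (a n))\<^sup>2)"
proof -
  have "eventually (\<lambda>n. norm (a n) < 1) sequentially"
    by (rule order_tendstoD(2)[OF summable_LIMSEQ_zero[OF assms]]) simp
  then have "eventually (\<lambda>n. norm ((norm (a n))\<^sup>2) \<le> norm (a n)) sequentially"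
    by eventually_elim (simp add: power2_eq_square mult_left_le)
  then show ?thesis using assms by (rule summable_comparison_test_ev)
qed

lemma weighted_Cauchy_Schwarz_sum:
  fixes w y :: "'a \<Rightarrow> real"
  assumes "\<And>i. i \<in> I \<Longrightarrow> w i \<ge> 0"
  shows "(\<Sum>i\<in>I. w i * y i)\<^sup>2 \<le> (\<Sum>i\<in>I. w i) * (\<Sum>i\<in>I. w i * (y i)\<^sup>2)"
proof -
  have "(\<Sum>i\<in>I. sqrt (w i) * (sqrt (w i) * y i))\<^sup>2
        \<le> (\<Sum>i\<in>I. (sqrt (w i))\<^sup>2) * (\<Sum>i\<in>I. (sqrt (w i) * y i)\<^sup>2)"
    by (rule Cauchy_Schwarz_ineq_sum)
  moreover have "(\<Sum>i\<in>I. sqrt (w i) * (sqrt (w i) * y i)) = (\<Sum>i\<in>I. w i * y i)"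
    using assms by (intro sum.cong refl) (simp add: mult.assoc[symmetric])
  moreover have "(\<Sum>i\<in>I. (sqrt (w i))\<^sup>2) = (\<Sum>i\<in>I. w i)"
    using assms by (intro sum.cong refl) simp
  moreover have "(\<Sum>i\<in>I. (sqrt (w i) * y i)\<^sup>2) = (\<Sum>i\<in>I. w i * (y i)\<^sup>2)"
    using assms by (intro sum.cong refl) (simp add: power_mult_distrib)
  ultimately show ?thesis by simp
qed

lemma weighted_Cauchy_Schwarz_suminf:
  fixes w y :: "nat \<Rightarrow> real"
  assumes w0: "\<And>i. w i \<ge> 0" and sw: "summable w"
    and s1: "summable (\<lambda>i. w i * y i)" and s2: "summable (\<lambda>i. w i * (y i)\<^sup>2)"
  shows "(\<Sum>i. w i * y i)\<^sup>2 \<le> (\<Sum>i. w i) * (\<Sum>i. w i * (y i)\<^sup>2)"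
proof (rule LIMSEQ_le_const2)
  show "(\<lambda>N. (\<Sum>i<N. w i * y i)\<^sup>2) \<longlonglongrightarrow> (\<Sum>i. w i * y i)\<^sup>2"
    by (intro tendsto_power summable_LIMSEQ s1)
  show "\<exists>N. \<forall>n\<ge>N. (\<Sum>i<n. w i * y i)\<^sup>2 \<le> (\<Sum>i. w i) * (\<Sum>i. w i * (y i)\<^sup>2)"
  proof (intro exI allI impI)
    fix n :: nat
    have "(\<Sum>i<n. w i * y i)\<^sup>2 \<le> (\<Sum>i<n. w i) * (\<Sum>i<n. w i * (y i)\<^sup>2)"
      using w0 by (intro weighted_Cauchy_Schwarz_sum) auto
    also have "\<dots> \<le> (\<Sum>i. w i) * (\<Sum>i. w i * (y i)\<^sup>2)"
      using w0 by (intro mult_mono sum_le_suminf sw s2 sum_nonneg suminf_nonneg)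
        (auto intro: mult_nonneg_nonneg)
    finally show "(\<Sum>i<n. w i * y i)\<^sup>2 \<le> (\<Sum>i. w i) * (\<Sum>i. w i * (y i)\<^sup>2)" .
  qed
qed

lemma sum_shift_le_suminf:
  fixes h :: "nat \<Rightarrow> real"
  assumes "summable h" "\<And>n. h n \<ge> 0" "finite J"
  shows "(\<Sum>j\<in>J. h (j + k)) \<le> suminf h"
proof -
  have "(\<Sum>j\<in>J. h (j + k)) = sum h ((\<lambda>j. j + k) ` J)"
    by (subst sum.reindex) (auto simp: inj_on_def)
  also have "\<dots> \<le> suminf h" using assms by (intro sum_le_suminf) auto
  finally show ?thesis .
qed

lemma sum_mult_shift_le_half_sum_squares:
  fixes b c :: "nat \<Rightarrow> real"
  assumes b: "summable (\<lambda>j. (b j)\<^sup>2)" and c: "summable (\<lambda>j. (c j)\<^sup>2)"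
  shows "(\<Sum>j\<le>N. b j * c (j + k)) \<le> ((\<Sum>j. (b j)\<^sup>2) + (\<Sum>j. (c j)\<^sup>2)) / 2"
proof -
  have "b j * c (j + k) \<le> ((b j)\<^sup>2 + (c (j + k))\<^sup>2) / 2" for j
    using sum_squares_bound[of "b j" "c (j + k)"] by simp
  then have "(\<Sum>j\<le>N. b j * c (j + k)) \<le> (\<Sum>j\<le>N. ((b j)\<^sup>2 + (c (j + k))\<^sup>2) / 2)"
    by (intro sum_mono)
  also have "\<dots> = ((\<Sum>j\<le>N. (b j)\<^sup>2) + (\<Sum>j\<le>N. (c (j + k))\<^sup>2)) / 2"
    by (simp only: sum.distrib sum_divide_distrib[symmetric])
  also have "\<dots> \<le> ((\<Sum>j. (b j)\<^sup>2) + (\<Sum>j. (c j)\<^sup>2)) / 2"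
    using sum_le_suminf[OF b] sum_shift_le_suminf[OF c] by (intro divide_right_mono add_mono) auto
  finally show ?thesis .
qed

lemma summable_shifted_weighted_squares:
  fixes a b :: "nat \<Rightarrow> real"
  assumes a: "\<And>k. a k \<ge> 0" "summable a" and b: "summable (\<lambda>j. (b j)\<^sup>2)"
  shows "summable (\<lambda>k. a k * (b (k + j))\<^sup>2)"
    and "summable (\<lambda>j. \<Sum>k. a k * (b (k + j))\<^sup>2)"
proof -
  define G where "G = (\<Sum>j. (b j)\<^sup>2)"
  have shift_le: "(\<Sum>j\<in>J. (b (j + k))\<^sup>2) \<le> G" if "finite J" for J k
    unfolding G_def using b that by (intro sum_shift_le_suminf) auto
  have "norm (a k * (b (k + j))\<^sup>2) \<le> a k * G" for k j
    using shift_le[of "{0}" "k + j"] a(1)[of k] by (simp add: mult_left_mono)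
  then show inner: "summable (\<lambda>k. a k * (b (k + j))\<^sup>2)" for j
    using summable_mult2[OF a(2), of G] by (rule summable_comparison_test'[rotated])
  show "summable (\<lambda>j. \<Sum>k. a k * (b (k + j))\<^sup>2)"
  proof (rule summableI_nonneg_bounded)
    show "0 \<le> (\<Sum>k. a k * (b (k + j))\<^sup>2)" for j
      using inner a(1) by (intro suminf_nonneg) auto
    fix N
    have "(\<Sum>j<N. \<Sum>k. a k * (b (k + j))\<^sup>2) = (\<Sum>k. \<Sum>j<N. a k * (b (k + j))\<^sup>2)"
      using inner by (rule suminf_sum[symmetric])
    also have "\<dots> \<le> (\<Sum>k. a k * G)"
    proof (rule suminf_le)
      show "(\<Sum>j<N. a k * (b (k + j))\<^sup>2) \<le> a k * G" for k
        using shift_le[of "{..<N}" k] a(1)[of k]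
        by (simp add: sum_distrib_left[symmetric] add.commute mult_left_mono)
    qed (use inner a(2) in \<open>auto intro: summable_sum summable_mult2\<close>)
    also have "\<dots> = (\<Sum>k. a k) * G" using a(2) by (rule suminf_mult2[symmetric])
    finally show "(\<Sum>j<N. \<Sum>k. a k * (b (k + j))\<^sup>2) \<le> (\<Sum>k. a k) * G" .
  qed
qed

lemma sum_atMost_rev: "(\<Sum>j\<le>(i::nat). g (i - j)) = (\<Sum>j\<le>i. g j)"
  by (rule sum.reindex_bij_witness[where i="\<lambda>j. i - j" and j="\<lambda>j. i - j"]) auto

lemma infsum_eq_suminf:
  assumes "(f :: nat \<Rightarrow> 'a::{t2_space,topological_comm_monoid_add}) summable_on UNIV"
  shows "infsum f UNIV = suminf f"
  using has_sum_imp_sums[OF has_sum_infsum[OF assms]] by (simp add: sums_iff)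

lemma finite_subset_atMost_Times:
  assumes "finite (F :: (nat \<times> nat) set)"
  obtains N where "F \<subseteq> {..N} \<times> {..N}"
proof -
  define N where "N = Max (fst ` F \<union> snd ` F)"
  have "F \<subseteq> {..N} \<times> {..N}"
  proof
    fix p assume "p \<in> F"
    then have "fst p \<le> N" "snd p \<le> N" using assms unfolding N_def by (auto intro: Max_ge)
    then show "p \<in> {..N} \<times> {..N}" by (cases p) auto
  qed
  then show ?thesis by (rule that)
qed

section \<open>Absolutely convergent Taylor series on the closed unit disc\<close>

lemma open_superset_cball_imp_ball:
  fixes U :: "complex set"
  assumes "open U" "cball 0 1 \<subseteq> U"
  obtains \<rho> where "\<rho> > 1" "ball 0 \<rho> \<subseteq> U"
proof -
  obtain \<epsilon> where \<epsilon>: "\<epsilon> > 0" "(\<Union>x\<in>cball 0 1. ball x \<epsilon>) \<subseteq> U"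
    using compact_subset_open_imp_ball_epsilon_subset[OF compact_cball assms] .
  have "z \<in> U" if z: "norm z < 1 + \<epsilon>" for z :: complex
  proof (cases "norm z \<le> 1")
    case True
    then show ?thesis using assms(2) by auto
  next
    case False
    then have "z \<noteq> 0" by auto
    then have "z = norm z *\<^sub>R sgn z" by (simp add: sgn_div_norm)
    then have "sgn z - z = (1 - norm z) *\<^sub>R sgn z" by (subst (2) \<open>z = _\<close>) (simp add: algebra_simps)
    then have "dist (sgn z) z = norm z - 1" using False \<open>z \<noteq> 0\<close> by (simp add: dist_norm norm_sgn)
    then have "z \<in> ball (sgn z) \<epsilon>" using z by simp
    moreover have "sgn z \<in> cball 0 1" using False by (simp add: norm_sgn)
    ultimately show ?thesis using \<epsilon>(2) by blast
  qed
  then have "ball 0 (1 + \<epsilon>) \<subseteq> U" by auto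
  with \<epsilon>(1) show thesis by (intro that[of "1 + \<epsilon>"]) auto
qed

lemma has_fps_expansion_abs_summable:
  fixes F :: "complex fps"
  assumes "f has_fps_expansion F" "f holomorphic_on U" "open U" "cball 0 1 \<subseteq> U"
  shows "summable (\<lambda>n. norm (fps_nth F n))"
proof -
  obtain \<rho> where \<rho>: "\<rho> > 1" "ball 0 \<rho> \<subseteq> U"
    using open_superset_cball_imp_ball assms(3,4) .
  have "fps_conv_radius F \<ge> ereal \<rho>"
    using assms(1) holomorphic_on_subset[OF assms(2) \<rho>(2)]
    by (intro holomorphic_on_imp_fps_conv_radius_ge) auto
  with \<rho>(1) have "ereal (norm (1::complex)) < conv_radius (fps_nth F)"
    by (simp add: fps_conv_radius_def less_le_trans[of "ereal 1" "ereal \<rho>"])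
  from abs_summable_in_conv_radius[OF this] show ?thesis by simp
qed

lemma RH_inf_taylor_coeff_abs_summable:
  assumes "RH_inf \<Phi>"
  shows "summable (\<lambda>k. norm (taylor_coeff \<Phi> k $ i $ j))"
proof -
  obtain p q where q: "\<And>z. cmod z \<le> 1 \<Longrightarrow> poly q z \<noteq> 0"
    and pq: "\<And>z. \<Phi> z $ i $ j = poly p z / poly q z"
    using assms unfolding RH_inf_def by blast
  define U where "U = {z. poly q z \<noteq> 0}"
  have U: "open U" "cball 0 1 \<subseteq> U"
    using q unfolding U_def by (auto intro!: open_Collect_neq continuous_intros)
  have holo: "(\<lambda>z. \<Phi> z $ i $ j) holomorphic_on U"
    unfolding pq U_def by (intro holomorphic_intros) auto
  have "(\<lambda>z. \<Phi> z $ i $ j) has_fps_expansion fps_expansion (\<lambda>z. \<Phi> z $ i $ j) 0"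
    using U holo by (intro has_fps_expansion_fps_expansion) auto
  from has_fps_expansion_abs_summable[OF this holo U]
  show ?thesis by (simp add: taylor_coeff_def fps_expansion_def)
qed

section \<open>Stable matrices\<close>

definition mnorm :: "complex^'n^'m \<Rightarrow> real" where
  "mnorm M = (\<Sum>i\<in>UNIV. \<Sum>j\<in>UNIV. norm (M $ i $ j))"

lemma mnorm_nonneg: "mnorm M \<ge> 0"
  unfolding mnorm_def by (intro sum_nonneg) auto

lemma mnorm_mat_adj: "mnorm (mat_adj M) = mnorm M"
proof -
  have "mnorm (mat_adj M) = (\<Sum>i\<in>UNIV. \<Sum>j\<in>UNIV. norm (M $ j $ i))"
    by (simp add: mnorm_def mat_adj_def)
  also have "\<dots> = mnorm M"
    unfolding mnorm_def by (rule sum.swap)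
  finally show ?thesis .
qed

lemma norm_matrix_vector_mult_le: "norm (M *v v) \<le> mnorm M * norm v"
proof -
  have "norm (M *v v) \<le> (\<Sum>i\<in>UNIV. norm ((M *v v) $ i))"
    unfolding norm_vec_def by (rule L2_set_le_sum) auto
  also have "\<dots> \<le> (\<Sum>i\<in>UNIV. \<Sum>j\<in>UNIV. norm (M $ i $ j) * norm v)"
  proof (rule sum_mono)
    fix i
    have "norm ((M *v v) $ i) \<le> (\<Sum>j\<in>UNIV. norm (M $ i $ j * v $ j))"
      unfolding matrix_vector_mult_def by (simp add: norm_sum)
    also have "\<dots> \<le> (\<Sum>j\<in>UNIV. norm (M $ i $ j) * norm v)"
      unfolding norm_mult by (intro sum_mono mult_left_mono Finite_Cartesian_Product.norm_nth_le) auto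
    finally show "norm ((M *v v) $ i) \<le> (\<Sum>j\<in>UNIV. norm (M $ i $ j) * norm v)" .
  qed
  also have "\<dots> = mnorm M * norm v"
    by (simp add: mnorm_def sum_distrib_right)
  finally show ?thesis .
qed

lemma norm_vector_scalar_mult: "norm (c *s x) = norm c * norm (x :: 'a::real_normed_div_algebra^'n)"
  unfolding norm_vec_def by (simp add: norm_mult L2_set_right_distrib)

lemma norm_iterate_matrix_vector_mult_le:
  fixes A :: "complex^'n^'n"
  shows "norm (((*v) A ^^ n) x) \<le> mnorm A ^ n * norm x"
proof (induction n)
  case (Suc n)
  have "norm (A *v ((*v) A ^^ n) x) \<le> mnorm A * norm (((*v) A ^^ n) x)"
    by (rule norm_matrix_vector_mult_le)
  also have "\<dots> \<le> mnorm A * (mnorm A ^ n * norm x)"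
    using Suc by (intro mult_left_mono mnorm_nonneg)
  finally show ?case by (simp add: mult.assoc)
qed simp

lemma msc_mult_vector: "msc z A *v v = z *s (A *v v)"
  by (simp add: vec_eq_iff matrix_vector_mult_def msc_def sum_distrib_left mult.assoc)

lemma one_minus_msc_mult_vector: "(mat 1 - msc z A) *v v = v - z *s (A *v v)"
  by (simp add: matrix_vector_mult_diff_rdistrib msc_mult_vector)

lemma one_minus_msc_singular_imp_fixed_point:
  fixes A :: "complex^'n^'n"
  assumes "det (mat 1 - msc z A) = 0"
  obtains x where "x \<noteq> 0" "x = z *s (A *v x)"
proof -
  obtain x where "(mat 1 - msc z A) *v x = 0" "x \<noteq> 0"
    using assms invertible_det_nz invertible_left_inverse matrix_left_invertible_ker by metis
  then show thesis using that by (simp add: one_minus_msc_mult_vector)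
qed

lemma stable_det_one_minus_msc_nonzero:
  fixes A :: "complex^'n^'n"
  assumes "stable A" "cmod z \<le> 1"
  shows "det (mat 1 - msc z A) \<noteq> 0"
proof
  assume "det (mat 1 - msc z A) = 0"
  then obtain x where x: "x \<noteq> 0" "x = z *s (A *v x)"
    by (rule one_minus_msc_singular_imp_fixed_point)
  then have "z \<noteq> 0" by auto
  then have "A *v x = (1 / z) *s x" by (subst x(2)) simp
  then have "cmod (1 / z) < 1" using assms(1) x(1) unfolding stable_def by metis
  with \<open>z \<noteq> 0\<close> have "1 < cmod z" by (simp add: norm_divide)
  with assms(2) show False by simp
qed

lemma small_det_one_minus_msc_nonzero:
  fixes A :: "complex^'n^'n"
  assumes "norm z * mnorm A < 1"
  shows "det (mat 1 - msc z A) \<noteq> 0"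
proof
  assume "det (mat 1 - msc z A) = 0"
  then obtain x where x: "x \<noteq> 0" "x = z *s (A *v x)"
    by (rule one_minus_msc_singular_imp_fixed_point)
  then have "norm x \<le> norm z * (mnorm A * norm x)"
    using norm_matrix_vector_mult_le[of A x] norm_vector_scalar_mult[of z "A *v x"]
    by (metis mult_left_mono norm_ge_zero)
  also have "\<dots> < norm x" using assms x(1) by (simp add: mult.assoc[symmetric])
  finally show False by simp
qed

definition cramer_solution :: "complex^'n^'n \<Rightarrow> complex^'n \<Rightarrow> complex^'n" where
  "cramer_solution M b = (\<chi> k. det (\<chi> i j. if j = k then b $ i else M $ i $ j) / det M)"

lemma cramer_solution_eq:
  assumes "det M \<noteq> 0" "M *v x = b"
  shows "x = cramer_solution M b"
  using cramer[of M x b] assms by (simp add: cramer_solution_def)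

lemma holomorphic_on_det:
  fixes M :: "complex \<Rightarrow> complex^'n^'n"
  assumes "\<And>i j. (\<lambda>z. M z $ i $ j) holomorphic_on S"
  shows "(\<lambda>z. det (M z)) holomorphic_on S"
  unfolding det_def by (intro holomorphic_intros assms)

lemma holomorphic_on_cramer_solution:
  fixes M :: "complex \<Rightarrow> complex^'n^'n"
  assumes "\<And>i j. (\<lambda>z. M z $ i $ j) holomorphic_on S" "\<And>z. z \<in> S \<Longrightarrow> det (M z) \<noteq> 0"
  shows "(\<lambda>z. cramer_solution (M z) b $ k) holomorphic_on S"
proof -
  have "(\<lambda>z. if j = k then b $ i else M z $ i $ j) holomorphic_on S" for i j
    using assms(1) by (cases "j = k") auto
  then show ?thesis
    unfolding cramer_solution_def using assms
    by (auto intro!: holomorphic_intros holomorphic_on_det)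
qed

lemma neumann_series:
  fixes A :: "complex^'n^'n"
  assumes "norm z * mnorm A < 1"
  shows "summable (\<lambda>n. (z ^ n) *s (((*v) A ^^ n) x))"
    and "(mat 1 - msc z A) *v (\<Sum>n. (z ^ n) *s (((*v) A ^^ n) x)) = x"
proof -
  define u where "u n = (z ^ n) *s (((*v) A ^^ n) x)" for n
  have bound: "norm (u n) \<le> norm x * (norm z * mnorm A) ^ n" for n
  proof -
    have "norm (u n) = norm z ^ n * norm (((*v) A ^^ n) x)"
      by (simp add: u_def norm_vector_scalar_mult norm_power)
    also have "\<dots> \<le> norm z ^ n * (mnorm A ^ n * norm x)"
      by (intro mult_left_mono norm_iterate_matrix_vector_mult_le) auto
    finally show ?thesis by (simp add: power_mult_distrib mult_ac)
  qed
  have "summable (\<lambda>n. norm x * (norm z * mnorm A) ^ n)"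
    using assms mnorm_nonneg[of A] by (intro summable_mult summable_geometric) auto
  then show u: "summable (\<lambda>n. (z ^ n) *s (((*v) A ^^ n) x))"
    unfolding u_def[symmetric] using bound by (rule summable_comparison_test')
  have "(\<lambda>n. u n - u (Suc n)) sums (u 0 - 0)"
    by (intro telescope_sums' summable_LIMSEQ_zero u[folded u_def])
  moreover have "(\<lambda>n. u n - u (Suc n)) = (\<lambda>n. (mat 1 - msc z A) *v u n)"
    by (simp add: u_def one_minus_msc_mult_vector vector_scalar_commute mult.commute)
  moreover have "u 0 - 0 = x" by (simp add: u_def)
  ultimately have "(\<lambda>n. (mat 1 - msc z A) *v u n) sums x" by (simp only:)
  moreover have "(\<lambda>n. (mat 1 - msc z A) *v u n) sums ((mat 1 - msc z A) *v suminf u)"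
    using u[folded u_def] by (rule bounded_linear.sums[OF matrix_vector_mul_bounded_linear summable_sums])
  ultimately show "(mat 1 - msc z A) *v (\<Sum>n. (z ^ n) *s (((*v) A ^^ n) x)) = x"
    unfolding u_def by (blast intro: sums_unique2)
qed

lemma resolvent_has_fps_expansion:
  fixes A :: "complex^'n^'n"
  shows "(\<lambda>z. cramer_solution (mat 1 - msc z A) x $ k)
           has_fps_expansion Abs_fps (\<lambda>n. (((*v) A ^^ n) x) $ k)"
proof -
  define F where "F = Abs_fps (\<lambda>n. (((*v) A ^^ n) x) $ k)"
  define \<delta> where "\<delta> = 1 / (mnorm A + 1)"
  have \<delta>: "\<delta> > 0" "\<And>z::complex. norm z < \<delta> \<Longrightarrow> norm z * mnorm A < 1"
  proof -
    show "\<delta> > 0" using mnorm_nonneg[of A] by (simp add: \<delta>_def)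
    fix z :: complex assume "norm z < \<delta>"
    then have "norm z * mnorm A \<le> \<delta> * mnorm A" by (intro mult_right_mono mnorm_nonneg) auto
    also have "\<dots> < 1" using mnorm_nonneg[of A] by (simp add: \<delta>_def field_simps)
    finally show "norm z * mnorm A < 1" .
  qed
  have series: "(\<lambda>n. fps_nth F n * z ^ n) sums cramer_solution (mat 1 - msc z A) x $ k"
    if "norm z < \<delta>" for z
  proof -
    note neumann = neumann_series[OF \<delta>(2)[OF that], of x]
    have "(\<Sum>n. (z ^ n) *s (((*v) A ^^ n) x)) = cramer_solution (mat 1 - msc z A) x"
      using small_det_one_minus_msc_nonzero[OF \<delta>(2)[OF that]] neumann(2)
      by (rule cramer_solution_eq)
    moreover have "(\<lambda>n. ((z ^ n) *s (((*v) A ^^ n) x)) $ k)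
        sums (\<Sum>n. (z ^ n) *s (((*v) A ^^ n) x)) $ k"
      by (rule bounded_linear.sums[OF bounded_linear_vec_nth summable_sums[OF neumann(1)]])
    ultimately show ?thesis by (simp add: F_def mult.commute)
  qed
  have "fps_conv_radius F \<ge> norm (of_real (\<delta> / 2) :: complex)"
    unfolding fps_conv_radius_def
    by (rule conv_radius_geI) (use series[of "of_real (\<delta> / 2)"] \<delta>(1) in \<open>auto simp: sums_iff\<close>)
  then have "fps_conv_radius F > 0"
    using \<delta>(1) by (simp add: zero_ereal_def less_le_trans[of "ereal 0" "ereal (\<delta> / 2)"])
  moreover have "eventually (\<lambda>z. eval_fps F z = cramer_solution (mat 1 - msc z A) x $ k) (nhds 0)"
    using eventually_nhds_in_open[of "ball 0 \<delta>" 0] \<delta>(1)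
    by (auto elim!: eventually_mono simp: eval_fps_def series[THEN sums_unique, symmetric])
  ultimately show ?thesis by (simp add: F_def has_fps_expansion_def)
qed

(* The generating function of the iterates is the resolvent (I - zA)\<inverse> x, whose entries are
   rational without poles on the closed disc, so its Taylor series converges absolutely at z = 1. *)
lemma stable_iterate_component_abs_summable:
  fixes A :: "complex^'n^'n"
  assumes "stable A"
  shows "summable (\<lambda>n. norm ((((*v) A ^^ n) x) $ k))"
proof -
  define U where "U = {z. det (mat 1 - msc z A) \<noteq> 0}"
  have entries: "(\<lambda>z. (mat 1 - msc z A) $ i $ j) holomorphic_on S" for i j S
    by (simp add: msc_def mat_def) (auto intro!: holomorphic_intros)
  have U: "open U" "cball 0 1 \<subseteq> U"
    using stable_det_one_minus_msc_nonzero[OF assms]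
    unfolding U_def by (auto intro!: open_Collect_neq holomorphic_on_imp_continuous_on
        holomorphic_on_det entries)
  have "(\<lambda>z. cramer_solution (mat 1 - msc z A) x $ k) holomorphic_on U"
    by (rule holomorphic_on_cramer_solution[OF entries]) (simp add: U_def)
  from has_fps_expansion_abs_summable[OF resolvent_has_fps_expansion this U]
  show ?thesis by simp
qed

lemma norm_vec_square: "(norm x)\<^sup>2 = (\<Sum>k\<in>UNIV. (norm (x $ k))\<^sup>2)"
  unfolding norm_vec_def L2_set_def by (simp add: sum_nonneg)

lemma stable_iterate_square_summable:
  fixes A :: "complex^'n^'n"
  assumes "stable A"
  shows "summable (\<lambda>n. (norm (((*v) A ^^ n) x))\<^sup>2)"
  unfolding norm_vec_square
  by (intro summable_sum abs_summable_imp_square_summable stable_iterate_component_abs_summable assms)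

section \<open>The sequence space \<open>\<ell>\<^sup>2\<close>\<close>

lemma norm_cinner_le: "norm (cinner (x::complex^'k) y) \<le> norm x * norm y"
proof -
  have "norm (cinner x y) \<le> (\<Sum>i\<in>UNIV. norm (x$i * cnj (y$i)))"
    unfolding cinner_def by (rule norm_sum)
  also have "\<dots> = (\<Sum>i\<in>UNIV. \<bar>norm (x$i)\<bar> * \<bar>norm (y$i)\<bar>)" by (simp add: norm_mult)
  also have "\<dots> \<le> L2_set (\<lambda>i. norm (x$i)) UNIV * L2_set (\<lambda>i. norm (y$i)) UNIV"
    by (rule L2_set_mult_ineq)
  finally show ?thesis by (simp add: norm_vec_def)
qed

lemma norm_cinner_le_half_sum_squares: "norm (cinner (x::complex^'k) y) \<le> ((norm x)\<^sup>2 + (norm y)\<^sup>2) / 2"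
proof -
  have "norm x * norm y \<le> ((norm x)\<^sup>2 + (norm y)\<^sup>2) / 2"
    using sum_squares_bound[of "norm x" "norm y"] by (simp add: field_simps)
  then show ?thesis using norm_cinner_le[of x y] by linarith
qed

lemma cinner_self: "cinner (x::complex^'k) x = of_real ((norm x)\<^sup>2)"
  unfolding cinner_def norm_vec_square of_real_sum by (rule sum.cong[OF refl]) (rule complex_norm_square[symmetric])

lemma cinner_diff_left: "cinner ((x::complex^'k) - y) z = cinner x z - cinner y z"
  unfolding cinner_def by (simp add: algebra_simps sum_subtractf)

lemma cinner_diff_right: "cinner (x::complex^'k) (y - z) = cinner x y - cinner x z"
  unfolding cinner_def by (simp add: algebra_simps sum_subtractf)

lemma cinner_zero_right [simp]: "cinner (x::complex^'k) 0 = 0"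
  unfolding cinner_def by simp

lemma cinner_zero_left [simp]: "cinner 0 (y::complex^'k) = 0"
  unfolding cinner_def by simp

lemma cinner_sum_left: "cinner (\<Sum>j\<in>J. (v j::complex^'k)) y = (\<Sum>j\<in>J. cinner (v j) y)"
proof -
  have "cinner (\<Sum>j\<in>J. v j) y = (\<Sum>i\<in>UNIV. \<Sum>j\<in>J. v j $ i * cnj (y$i))"
    by (simp add: cinner_def sum_component sum_distrib_right)
  also have "\<dots> = (\<Sum>j\<in>J. \<Sum>i\<in>UNIV. v j $ i * cnj (y$i))" by (rule sum.swap)
  finally show ?thesis by (simp add: cinner_def)
qed

lemma cinner_mat_adj: "cinner ((M::complex^'n^'m) *v x) y = cinner x (mat_adj M *v y)"
proof -
  have L: "cinner (M *v x) y = (\<Sum>i\<in>UNIV. \<Sum>j\<in>UNIV. M$i$j * x$j * cnj (y$i))"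
    by (simp add: cinner_def matrix_vector_mult_def sum_distrib_right)
  have R: "cinner x (mat_adj M *v y) = (\<Sum>j\<in>UNIV. \<Sum>i\<in>UNIV. M$i$j * x$j * cnj (y$i))"
    by (simp add: cinner_def matrix_vector_mult_def mat_adj_def sum_distrib_left algebra_simps)
  show ?thesis unfolding L R by (rule sum.swap)
qed

lemma cinner_suminf_right:
  assumes "summable (v :: nat \<Rightarrow> complex^'k)"
  shows "cinner x (suminf v) = (\<Sum>n. cinner x (v n))"
proof -
  have s1: "summable (\<lambda>n. v n $ i)" for i
    using bounded_linear.summable[OF bounded_linear_vec_nth assms] .
  have c1: "(suminf v) $ i = (\<Sum>n. v n $ i)" for i
    using bounded_linear.suminf[OF bounded_linear_vec_nth assms] by simp
  have c2: "cnj (\<Sum>n. v n $ i) = (\<Sum>n. cnj (v n $ i))" for i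
    using sums_cnj[THEN iffD2, OF summable_sums[OF s1[of i]]] by (simp add: sums_iff)
  have s2: "summable (\<lambda>n. cnj (v n $ i))" for i
    using sums_cnj[THEN iffD2, OF summable_sums[OF s1[of i]]] by (simp add: sums_iff)
  have "cinner x (suminf v) = (\<Sum>i\<in>UNIV. x$i * (\<Sum>n. cnj (v n $ i)))"
    unfolding cinner_def c1 c2 ..
  also have "\<dots> = (\<Sum>i\<in>UNIV. \<Sum>n. x$i * cnj (v n $ i))"
    using s2 by (simp add: suminf_mult)
  also have "\<dots> = (\<Sum>n. \<Sum>i\<in>UNIV. x$i * cnj (v n $ i))"
    using s2 by (intro suminf_sum[symmetric] summable_mult)
  finally show ?thesis unfolding cinner_def .
qed

lemma l2_bounded:
  assumes "(f :: nat \<Rightarrow> complex^'k) \<in> l2"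
  obtains B where "\<And>n. norm (f n) \<le> B" "B \<ge> 0"
proof -
  have "(\<lambda>n. (norm (f n))\<^sup>2) \<longlonglongrightarrow> 0"
    using assms by (intro summable_LIMSEQ_zero) (simp add: l2_def)
  then have "Bseq (\<lambda>n. (norm (f n))\<^sup>2)" by (rule convergent_imp_Bseq[OF convergentI])
  then obtain K where K: "K > 0" "\<And>n. norm ((norm (f n))\<^sup>2) \<le> K" by (auto simp: Bseq_def)
  have "norm (f n) \<le> max 1 K" for n
  proof (cases "norm (f n) \<le> 1")
    case False
    then have "norm (f n) \<le> norm (f n) * norm (f n)" by (simp add: mult_le_cancel_left1)
    also have "\<dots> \<le> K" using K(2)[of n] by (simp add: power2_eq_square)
    finally show ?thesis by simp
  qed simp
  then show ?thesis using that[of "max 1 K"] by simp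
qed

lemma l2_diff:
  assumes "(f :: nat \<Rightarrow> complex^'k) \<in> l2" "g \<in> l2"
  shows "(\<lambda>j. f j - g j) \<in> l2"
proof -
  have b: "norm ((norm (f j - g j))\<^sup>2) \<le> 2 * (norm (f j))\<^sup>2 + 2 * (norm (g j))\<^sup>2" for j
  proof -
    have "norm (f j - g j) \<le> norm (f j) + norm (g j)" by (rule norm_triangle_ineq4)
    then have "(norm (f j - g j))\<^sup>2 \<le> (norm (f j) + norm (g j))\<^sup>2" by (rule power_mono) simp
    moreover have "2 * norm (f j) * norm (g j) \<le> (norm (f j))\<^sup>2 + (norm (g j))\<^sup>2"
      by (rule sum_squares_bound)
    ultimately show ?thesis unfolding power2_sum by simp
  qed
  have s: "summable (\<lambda>j. 2 * (norm (f j))\<^sup>2 + 2 * (norm (g j))\<^sup>2)"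
    using assms by (intro summable_add summable_mult) (auto simp: l2_def)
  have "summable (\<lambda>j. (norm (f j - g j))\<^sup>2)"
    by (rule summable_comparison_test[OF _ s]) (use b in blast)
  then show ?thesis by (simp add: l2_def)
qed

lemma l2_shift:
  assumes "(f :: nat \<Rightarrow> complex^'k) \<in> l2"
  shows "(\<lambda>j. f (j + k)) \<in> l2"
  using assms summable_iff_shift[where f="\<lambda>j. (norm (f j))\<^sup>2" and k=k] unfolding l2_def by simp

lemma l2inner_abs_summable:
  assumes "(f :: nat \<Rightarrow> complex^'k) \<in> l2" "g \<in> l2"
  shows "summable (\<lambda>j. norm (cinner (f j) (g j)))"
proof (rule summable_comparison_test[of _ "\<lambda>j. ((norm (f j))\<^sup>2 + (norm (g j))\<^sup>2) / 2"])
  show "\<exists>N. \<forall>n\<ge>N. norm (norm (cinner (f n) (g n))) \<le> ((norm (f n))\<^sup>2 + (norm (g n))\<^sup>2) / 2"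
    using norm_cinner_le_half_sum_squares by auto
  show "summable (\<lambda>j. ((norm (f j))\<^sup>2 + (norm (g j))\<^sup>2) / 2)"
    using assms by (intro summable_divide summable_add) (auto simp: l2_def)
qed

lemma l2inner_diff_left:
  assumes "(f :: nat \<Rightarrow> complex^'k) \<in> l2" "g \<in> l2" "h \<in> l2"
  shows "l2inner (\<lambda>j. f j - g j) h = l2inner f h - l2inner g h"
  unfolding l2inner_def cinner_diff_left
  by (rule suminf_diff[symmetric]; rule summable_norm_cancel; rule l2inner_abs_summable; fact)

lemma l2inner_diff_right:
  assumes "(f :: nat \<Rightarrow> complex^'k) \<in> l2" "g \<in> l2" "h \<in> l2"
  shows "l2inner f (\<lambda>j. g j - h j) = l2inner f g - l2inner f h"
  unfolding l2inner_def cinner_diff_right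
  by (rule suminf_diff[symmetric]; rule summable_norm_cancel; rule l2inner_abs_summable; fact)

lemma l2inner_self:
  assumes "(f :: nat \<Rightarrow> complex^'k) \<in> l2"
  shows "l2inner f f = of_real (\<Sum>j. (norm (f j))\<^sup>2)"
  unfolding l2inner_def cinner_self using assms
  by (intro suminf_of_real[symmetric]) (simp add: l2_def)

lemma l2inner_self_eq_zero:
  assumes "(f :: nat \<Rightarrow> complex^'k) \<in> l2" "l2inner f f = 0"
  shows "f = (\<lambda>j. 0)"
proof -
  have "(\<Sum>j. (norm (f j))\<^sup>2) = 0" using l2inner_self[OF assms(1)] assms(2) by simp
  then have "\<forall>j. (norm (f j))\<^sup>2 = 0" using assms(1)
    by (subst (asm) suminf_eq_zero_iff) (auto simp: l2_def)
  then show ?thesis by auto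
qed

lemma norm_l2inner_le_half_sum_squares:
  assumes "(f :: nat \<Rightarrow> complex^'k) \<in> l2" "g \<in> l2"
  shows "norm (l2inner f g) \<le> ((\<Sum>j. (norm (f j))\<^sup>2) + (\<Sum>j. (norm (g j))\<^sup>2)) / 2"
proof -
  have s: "summable (\<lambda>j. (norm (f j))\<^sup>2)" "summable (\<lambda>j. (norm (g j))\<^sup>2)"
    using assms by (auto simp: l2_def)
  have "norm (l2inner f g) \<le> (\<Sum>j. norm (cinner (f j) (g j)))"
    unfolding l2inner_def by (intro summable_norm l2inner_abs_summable assms)
  also have "\<dots> \<le> (\<Sum>j. ((norm (f j))\<^sup>2 + (norm (g j))\<^sup>2) / 2)"
    using s by (intro suminf_le norm_cinner_le_half_sum_squares l2inner_abs_summable assms summable_divide summable_add) auto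
  also have "\<dots> = (\<Sum>j. (norm (f j))\<^sup>2 + (norm (g j))\<^sup>2) / 2"
    by (rule suminf_divide) (intro summable_add s)
  also have "\<dots> = ((\<Sum>j. (norm (f j))\<^sup>2) + (\<Sum>j. (norm (g j))\<^sup>2)) / 2"
    using suminf_add[OF s] by simp
  finally show ?thesis .
qed

section \<open>Toeplitz operators with absolutely summable symbol\<close>

definition toeplitz_adj ::
  "(nat \<Rightarrow> complex^'m^'r) \<Rightarrow> (nat \<Rightarrow> complex^'r) \<Rightarrow> (nat \<Rightarrow> complex^'m)" where
  "toeplitz_adj \<Omega> g = (\<lambda>j. \<Sum>k. mat_adj (\<Omega> k) *v g (k + j))"

locale abs_summable_symbol =
  fixes \<Omega> :: "nat \<Rightarrow> complex^'m^'r"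
  assumes summable_symbol: "summable (\<lambda>k. mnorm (\<Omega> k))"
begin

definition "symbol_norm = (\<Sum>k. mnorm (\<Omega> k))"

lemma symbol_norm_nonneg: "symbol_norm \<ge> 0"
  unfolding symbol_norm_def by (intro suminf_nonneg summable_symbol mnorm_nonneg)

(* Young's inequality for the convolution T f = \<Omega> * f, via weighted Cauchy-Schwarz. *)
lemma toeplitz_in_l2:
  assumes f: "(f :: nat \<Rightarrow> complex^'m) \<in> l2"
  shows "toeplitz \<Omega> f \<in> l2"
proof -
  define a where "a = (\<lambda>k. mnorm (\<Omega> k))"
  define b where "b = (\<lambda>j. norm (f j))"
  have a0: "a k \<ge> 0" for k by (simp add: a_def mnorm_nonneg)
  have b0: "b j \<ge> 0" for j by (simp add: b_def)
  have sa: "summable a" using summable_symbol by (simp add: a_def)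
  have sb: "summable (\<lambda>j. (b j)\<^sup>2)" using f by (simp add: l2_def b_def)
  define E where "E i = (\<Sum>j\<le>i. (b j)\<^sup>2 * a (i - j))" for i
  have sE: "summable E"
    unfolding E_def using sa sb a0 b0 by (intro summable_Cauchy_product) auto
  have bound: "(norm (toeplitz \<Omega> f i))\<^sup>2 \<le> symbol_norm * E i" for i
  proof -
    have "norm (toeplitz \<Omega> f i) \<le> (\<Sum>j\<le>i. norm (\<Omega> (i - j) *v f j))"
      unfolding toeplitz_def by (rule norm_sum)
    also have "\<dots> \<le> (\<Sum>j\<le>i. a (i - j) * b j)"
      by (intro sum_mono) (simp add: a_def b_def norm_matrix_vector_mult_le)
    finally have n1: "norm (toeplitz \<Omega> f i) \<le> (\<Sum>j\<le>i. a (i - j) * b j)" .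
    have "(norm (toeplitz \<Omega> f i))\<^sup>2 \<le> (\<Sum>j\<le>i. a (i - j) * b j)\<^sup>2"
      using n1 by (intro power_mono) auto
    also have "\<dots> \<le> (\<Sum>j\<le>i. a (i - j)) * (\<Sum>j\<le>i. a (i - j) * (b j)\<^sup>2)"
      using a0 by (intro weighted_Cauchy_Schwarz_sum) auto
    also have "\<dots> \<le> symbol_norm * E i"
    proof (rule mult_mono)
      show "(\<Sum>j\<le>i. a (i - j)) \<le> symbol_norm"
        unfolding sum_atMost_rev[of a i] symbol_norm_def a_def[symmetric]
        using sa a0 by (intro sum_le_suminf) (auto simp: a_def)
      show "(\<Sum>j\<le>i. a (i - j) * (b j)\<^sup>2) \<le> E i" unfolding E_def by (simp add: mult.commute)
      show "0 \<le> symbol_norm" by (rule symbol_norm_nonneg)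
      show "0 \<le> (\<Sum>j\<le>i. a (i - j) * (b j)\<^sup>2)" using a0 by (intro sum_nonneg) auto
    qed
    finally show ?thesis .
  qed
  have "summable (\<lambda>i. (norm (toeplitz \<Omega> f i))\<^sup>2)"
    by (rule summable_comparison_test[OF _ summable_mult[OF sE, of symbol_norm]]) (use bound in auto)
  then show ?thesis by (simp add: l2_def)
qed

lemma toeplitz_adj_terms_abs_summable:
  assumes g: "(g :: nat \<Rightarrow> complex^'r) \<in> l2"
  shows "summable (\<lambda>k. norm (mat_adj (\<Omega> k) *v g (k + j)))"
proof -
  obtain B where B: "\<And>n. norm (g n) \<le> B" "B \<ge> 0" using l2_bounded[OF g] by blast
  show ?thesis
  proof (rule summable_comparison_test[OF _ summable_mult2[OF summable_symbol, of B]])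
    show "\<exists>N. \<forall>n\<ge>N. norm (norm (mat_adj (\<Omega> n) *v g (n + j))) \<le> mnorm (\<Omega> n) * B"
    proof (intro exI allI impI)
      fix n
      have "norm (mat_adj (\<Omega> n) *v g (n + j)) \<le> mnorm (mat_adj (\<Omega> n)) * norm (g (n + j))"
        by (rule norm_matrix_vector_mult_le)
      also have "\<dots> \<le> mnorm (\<Omega> n) * B" unfolding mnorm_mat_adj
        by (intro mult_left_mono B mnorm_nonneg)
      finally show "norm (norm (mat_adj (\<Omega> n) *v g (n + j))) \<le> mnorm (\<Omega> n) * B" by simp
    qed
  qed
qed

lemma toeplitz_adj_in_l2:
  assumes g: "(g :: nat \<Rightarrow> complex^'r) \<in> l2"
  shows "toeplitz_adj \<Omega> g \<in> l2"
proof -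
  define a where "a = (\<lambda>k. mnorm (\<Omega> k))"
  define \<beta> where "\<beta> = (\<lambda>j. norm (g j))"
  have a0: "a k \<ge> 0" for k by (simp add: a_def mnorm_nonneg)
  have sa: "summable a" using summable_symbol by (simp add: a_def)
  have sb: "summable (\<lambda>j. (\<beta> j)\<^sup>2)" using g by (simp add: l2_def \<beta>_def)
  obtain B where B: "\<And>n. \<beta> n \<le> B" using l2_bounded[OF g] \<beta>_def by blast
  note squares = summable_shifted_weighted_squares[OF a0 sa sb]
  have s1: "summable (\<lambda>k. a k * \<beta> (k + j))" for j
    by (rule summable_comparison_test[OF _ summable_mult2[OF sa, of B]])
      (use a0 B in \<open>auto intro!: mult_left_mono simp: \<beta>_def\<close>)
  have bound: "(norm (toeplitz_adj \<Omega> g j))\<^sup>2 \<le> symbol_norm * (\<Sum>k. a k * (\<beta> (k + j))\<^sup>2)" for j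
  proof -
    have "norm (toeplitz_adj \<Omega> g j) \<le> (\<Sum>k. norm (mat_adj (\<Omega> k) *v g (k + j)))"
      unfolding toeplitz_adj_def using toeplitz_adj_terms_abs_summable[OF g] by (rule summable_norm)
    also have "\<dots> \<le> (\<Sum>k. a k * \<beta> (k + j))"
    proof (rule suminf_le)
      show "norm (mat_adj (\<Omega> k) *v g (k + j)) \<le> a k * \<beta> (k + j)" for k
        using norm_matrix_vector_mult_le[of "mat_adj (\<Omega> k)" "g (k + j)"]
        by (simp add: mnorm_mat_adj a_def \<beta>_def)
    qed (use toeplitz_adj_terms_abs_summable[OF g] s1 in auto)
    finally have "(norm (toeplitz_adj \<Omega> g j))\<^sup>2 \<le> (\<Sum>k. a k * \<beta> (k + j))\<^sup>2"
      by (intro power_mono) auto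
    also have "\<dots> \<le> (\<Sum>k. a k) * (\<Sum>k. a k * (\<beta> (k + j))\<^sup>2)"
      by (rule weighted_Cauchy_Schwarz_suminf[OF a0 sa s1 squares(1)])
    finally show ?thesis by (simp add: symbol_norm_def a_def)
  qed
  have "summable (\<lambda>j. (norm (toeplitz_adj \<Omega> g j))\<^sup>2)"
    by (rule summable_comparison_test[OF _ summable_mult[OF squares(2), of symbol_norm]])
      (use bound in auto)
  then show ?thesis by (simp add: l2_def)
qed

lemma toeplitz_adj_diff:
  assumes "(g1 :: nat \<Rightarrow> complex^'r) \<in> l2" "g2 \<in> l2"
  shows "toeplitz_adj \<Omega> (\<lambda>j. g1 j - g2 j) = (\<lambda>j. toeplitz_adj \<Omega> g1 j - toeplitz_adj \<Omega> g2 j)"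
proof
  fix j
  have "summable (\<lambda>k. mat_adj (\<Omega> k) *v g1 (k + j))" "summable (\<lambda>k. mat_adj (\<Omega> k) *v g2 (k + j))"
    using toeplitz_adj_terms_abs_summable[OF assms(1)] toeplitz_adj_terms_abs_summable[OF assms(2)]
    by (auto intro: summable_norm_cancel)
  then show "toeplitz_adj \<Omega> (\<lambda>j. g1 j - g2 j) j = toeplitz_adj \<Omega> g1 j - toeplitz_adj \<Omega> g2 j"
    unfolding toeplitz_adj_def by (simp add: matrix_vector_mult_diff_distrib suminf_diff)
qed


lemma toeplitz_pairing_abs_summable:
  assumes f: "(f :: nat \<Rightarrow> complex^'m) \<in> l2" and g: "(g :: nat \<Rightarrow> complex^'r) \<in> l2"
  shows "(\<lambda>(j, k). norm (cinner (\<Omega> k *v f j) (g (j + k)))) summable_on UNIV"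
proof (rule nonneg_bdd_above_summable_on, simp add: case_prod_beta, rule bdd_aboveI2)
  define a where "a = (\<lambda>k. mnorm (\<Omega> k))"
  define b where "b = (\<lambda>j. norm (f j))"
  define \<beta> where "\<beta> = (\<lambda>j. norm (g j))"
  define Bf where "Bf = (\<Sum>j. (b j)\<^sup>2)"
  define Bg where "Bg = (\<Sum>j. (\<beta> j)\<^sup>2)"
  have a0: "a k \<ge> 0" for k by (simp add: a_def mnorm_nonneg)
  have sb: "summable (\<lambda>j. (b j)\<^sup>2)" using f by (simp add: l2_def b_def)
  have sbe: "summable (\<lambda>j. (\<beta> j)\<^sup>2)" using g by (simp add: l2_def \<beta>_def)
  have term_bound: "norm (cinner (\<Omega> k *v f j) (g (j + k))) \<le> a k * (b j * \<beta> (j + k))" for j k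
  proof -
    have "norm (cinner (\<Omega> k *v f j) (g (j + k))) \<le> norm (\<Omega> k *v f j) * norm (g (j + k))"
      by (rule norm_cinner_le)
    also have "\<dots> \<le> (a k * b j) * \<beta> (j + k)"
      unfolding a_def b_def \<beta>_def by (intro mult_right_mono norm_matrix_vector_mult_le norm_ge_zero)
    finally show ?thesis by (simp add: mult.assoc)
  qed
  have column_bound: "(\<Sum>j\<le>N. b j * \<beta> (j + k)) \<le> (Bf + Bg) / 2" for N k
    unfolding Bf_def Bg_def by (rule sum_mult_shift_le_half_sum_squares[OF sb sbe])
  fix F :: "(nat \<times> nat) set" assume "F \<in> {F. F \<subseteq> UNIV \<and> finite F}"
  then obtain N where N: "F \<subseteq> {..N} \<times> {..N}" using finite_subset_atMost_Times by blast
  have "(\<Sum>(j, k)\<in>F. norm (cinner (\<Omega> k *v f j) (g (j + k))))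
      \<le> (\<Sum>(j, k)\<in>{..N} \<times> {..N}. norm (cinner (\<Omega> k *v f j) (g (j + k))))"
    using N by (intro sum_mono2) auto
  also have "\<dots> \<le> (\<Sum>(j, k)\<in>{..N} \<times> {..N}. a k * (b j * \<beta> (j + k)))"
    using term_bound by (intro sum_mono) (simp add: case_prod_beta)
  also have "\<dots> = (\<Sum>j\<le>N. \<Sum>k\<le>N. a k * (b j * \<beta> (j + k)))"
    by (rule sum.cartesian_product[symmetric])
  also have "\<dots> = (\<Sum>k\<le>N. a k * (\<Sum>j\<le>N. b j * \<beta> (j + k)))"
    by (subst sum.swap) (simp add: sum_distrib_left)
  also have "\<dots> \<le> (\<Sum>k\<le>N. a k * ((Bf + Bg) / 2))"
    using a0 column_bound by (intro sum_mono mult_left_mono) auto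
  also have "\<dots> \<le> symbol_norm * ((Bf + Bg) / 2)"
    unfolding sum_distrib_right[symmetric] symbol_norm_def a_def
    using summable_symbol sb sbe unfolding Bf_def Bg_def
    by (intro mult_right_mono sum_le_suminf divide_nonneg_pos add_nonneg_nonneg suminf_nonneg)
      (auto simp: mnorm_nonneg)
  finally show "(\<Sum>(j, k)\<in>F. norm (cinner (\<Omega> k *v f j) (g (j + k))))
      \<le> symbol_norm * ((Bf + Bg) / 2)" .
qed

(* Both sides sum the same absolutely summable double series: by diagonals on the left,
   by rows on the right. *)
lemma l2inner_toeplitz:
  assumes f: "(f :: nat \<Rightarrow> complex^'m) \<in> l2" and g: "(g :: nat \<Rightarrow> complex^'r) \<in> l2"
  shows "l2inner (toeplitz \<Omega> f) g = l2inner f (toeplitz_adj \<Omega> g)"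
proof -
  define c where "c j k = cinner (\<Omega> k *v f j) (g (j + k))" for j k
  have "(\<lambda>p. norm ((\<lambda>(j, k). c j k) p)) summable_on UNIV"
    using toeplitz_pairing_abs_summable[OF f g] by (simp add: c_def case_prod_unfold)
  then have summ: "(\<lambda>(j, k). c j k) summable_on UNIV \<times> UNIV"
    by (simp add: abs_summable_summable)
  have row: "infsum (c j) UNIV = cinner (f j) (toeplitz_adj \<Omega> g j)" for j
  proof -
    have "infsum (c j) UNIV = (\<Sum>k. c j k)"
      by (rule infsum_eq_suminf[OF summable_on_SigmaD1[OF summ]]) simp
    also have "\<dots> = (\<Sum>k. cinner (f j) (mat_adj (\<Omega> k) *v g (k + j)))"
      by (simp add: c_def cinner_mat_adj add.commute)
    also have "\<dots> = cinner (f j) (toeplitz_adj \<Omega> g j)"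
      unfolding toeplitz_adj_def
      by (rule cinner_suminf_right[symmetric, OF summable_norm_cancel[OF toeplitz_adj_terms_abs_summable[OF g]]])
    finally show ?thesis .
  qed
  have rows: "l2inner f (toeplitz_adj \<Omega> g) = infsum (\<lambda>(j, k). c j k) UNIV"
  proof -
    have "infsum (\<lambda>j. infsum (c j) UNIV) UNIV = infsum (\<lambda>(j, k). c j k) (UNIV \<times> UNIV)"
      by (rule infsum_Sigma'_banach[OF summ])
    moreover have "(\<lambda>j. infsum (c j) UNIV) summable_on UNIV"
      by (rule summable_on_Sigma_banach[OF summ])
    ultimately show ?thesis
      unfolding l2inner_def using row by (simp add: infsum_eq_suminf)
  qed
  define D where "D = Sigma (UNIV :: nat set) (\<lambda>i. {..i})"
  define h where "h = (\<lambda>(j :: nat, k :: nat). (j + k, j))"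
  define d where "d = (\<lambda>(i, j). c j (i - j))"
  have bij: "bij_betw h UNIV D"
    by (rule bij_betw_byWitness[where f' = "\<lambda>(i, j). (j, i - j)"]) (auto simp: h_def D_def)
  have dh: "(\<lambda>p. d (h p)) = (\<lambda>(j, k). c j k)" by (auto simp: d_def h_def)
  have diag_summ: "d summable_on D"
    using summable_on_reindex_bij_betw[OF bij, of d] summ by (simp add: dh)
  have diag_sum: "infsum d D = infsum (\<lambda>(j, k). c j k) UNIV"
    using infsum_reindex_bij_betw[OF bij, of d] by (simp add: dh)
  have diag: "(\<Sum>j\<le>i. c j (i - j)) = cinner (toeplitz \<Omega> f i) (g i)" for i
    unfolding toeplitz_def cinner_sum_left c_def by (intro sum.cong refl) auto
  have diagonals: "l2inner (toeplitz \<Omega> f) g = infsum d D"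
  proof -
    have ds: "(\<lambda>(i, j). c j (i - j)) summable_on Sigma UNIV atMost"
      using diag_summ by (simp add: d_def D_def)
    have "infsum (\<lambda>i. infsum (\<lambda>j. c j (i - j)) {..i}) UNIV = infsum d D"
      using infsum_Sigma'_banach[OF ds] by (simp add: d_def D_def)
    moreover have "(\<lambda>i. infsum (\<lambda>j. c j (i - j)) {..i}) summable_on UNIV"
      by (rule summable_on_Sigma_banach[OF ds])
    ultimately show ?thesis
      unfolding l2inner_def using diag by (simp add: infsum_eq_suminf)
  qed
  show ?thesis using rows diagonals diag_sum by simp
qed

lemma l2_adjoint_toeplitz:
  assumes g: "(g :: nat \<Rightarrow> complex^'r) \<in> l2"
  shows "l2_adjoint (toeplitz \<Omega>) g = toeplitz_adj \<Omega> g"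
  unfolding l2_adjoint_def
proof (rule the_equality)
  show "toeplitz_adj \<Omega> g \<in> l2 \<and> (\<forall>f\<in>l2. l2inner (toeplitz \<Omega> f) g = l2inner f (toeplitz_adj \<Omega> g))"
    using toeplitz_adj_in_l2[OF g] l2inner_toeplitz[OF _ g] by blast
next
  fix h assume h: "h \<in> l2 \<and> (\<forall>f\<in>l2. l2inner (toeplitz \<Omega> f) g = l2inner f h)"
  define e where "e = (\<lambda>j. h j - toeplitz_adj \<Omega> g j)"
  have e: "e \<in> l2" unfolding e_def using h toeplitz_adj_in_l2[OF g] by (intro l2_diff) auto
  have "l2inner e h = l2inner e (toeplitz_adj \<Omega> g)" using h l2inner_toeplitz[OF e g] e by auto
  then have "l2inner e e = 0" unfolding e_def using h toeplitz_adj_in_l2[OF g] e[unfolded e_def]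
    by (subst l2inner_diff_right) auto
  then have "e = (\<lambda>j. 0)" by (rule l2inner_self_eq_zero[OF e])
  then show "h = toeplitz_adj \<Omega> g" by (auto simp: e_def fun_eq_iff)
qed

(* If T\<^sup>* g = 0, then g is orthogonal to the range of T. Approximating g by some T u with
   \<parallel>T u - g\<parallel> < \<parallel>g\<parallel> gives \<parallel>g\<parallel>\<^sup>2 = |\<langle>T u - g, g\<rangle>| \<le> (\<parallel>T u - g\<parallel>\<^sup>2 + \<parallel>g\<parallel>\<^sup>2) / 2 < \<parallel>g\<parallel>\<^sup>2. *)
lemma toeplitz_adj_eq_zero:
  assumes dense: "dense_range_l2 (toeplitz \<Omega>)" and g: "(g :: nat \<Rightarrow> complex^'r) \<in> l2"
    and z: "toeplitz_adj \<Omega> g = (\<lambda>j. 0)"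
  shows "g = (\<lambda>j. 0)"
proof -
  define G where "G = (\<Sum>j. (norm (g j))\<^sup>2)"
  have G0: "G \<ge> 0" unfolding G_def using g by (intro suminf_nonneg) (auto simp: l2_def)
  have "\<not> G > 0"
  proof
    assume Gp: "G > 0"
    obtain u where u: "u \<in> l2" and ul: "l2norm (\<lambda>j. toeplitz \<Omega> u j - g j) < sqrt G"
      using dense g Gp unfolding dense_range_l2_def by (meson real_sqrt_gt_zero)
    define x where "x = (\<lambda>j. toeplitz \<Omega> u j - g j)"
    have Tu: "toeplitz \<Omega> u \<in> l2" by (rule toeplitz_in_l2[OF u])
    have x: "x \<in> l2" unfolding x_def using Tu g by (rule l2_diff)
    define X where "X = (\<Sum>j. (norm (x j))\<^sup>2)"
    have "sqrt X < sqrt G" using ul by (simp add: l2norm_def X_def x_def)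
    then have XG: "X < G" by simp
    have "l2inner (toeplitz \<Omega> u) g = l2inner u (toeplitz_adj \<Omega> g)" by (rule l2inner_toeplitz[OF u g])
    also have "\<dots> = 0" by (simp add: z l2inner_def)
    finally have Tg: "l2inner (toeplitz \<Omega> u) g = 0" .
    have "l2inner x g = l2inner (toeplitz \<Omega> u) g - l2inner g g"
      unfolding x_def by (rule l2inner_diff_left[OF Tu g g])
    then have "l2inner x g = - of_real G" using l2inner_self[OF g] Tg by (simp add: G_def)
    then have "G = norm (l2inner x g)" using G0 by simp
    also have "\<dots> \<le> (X + G) / 2" unfolding X_def G_def by (rule norm_l2inner_le_half_sum_squares[OF x g])
    finally show False using XG by simp
  qed
  then have "G = 0" using G0 by simp
  then have "l2inner g g = 0" using l2inner_self[OF g] by (simp add: G_def)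
  then show ?thesis by (rule l2inner_self_eq_zero[OF g])
qed

lemma inj_on_toeplitz_adj:
  assumes "dense_range_l2 (toeplitz \<Omega>)"
  shows "inj_on (toeplitz_adj \<Omega>) (l2 :: (nat \<Rightarrow> complex^'r) set)"
proof (rule inj_onI)
  fix g1 g2 :: "nat \<Rightarrow> complex^'r"
  assume g: "g1 \<in> l2" "g2 \<in> l2" and "toeplitz_adj \<Omega> g1 = toeplitz_adj \<Omega> g2"
  then have "toeplitz_adj \<Omega> (\<lambda>j. g1 j - g2 j) = (\<lambda>j. 0)" using toeplitz_adj_diff[OF g] by simp
  then have "(\<lambda>j. g1 j - g2 j) = (\<lambda>j. 0)" using toeplitz_adj_eq_zero[OF assms l2_diff[OF g]] by blast
  then show "g1 = g2" by (auto simp: fun_eq_iff)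
qed

lemma toeplitz_adj_image_diff:
  assumes "u \<in> toeplitz_adj \<Omega> ` l2" "v \<in> toeplitz_adj \<Omega> ` l2"
  shows "(\<lambda>j. u j - v j) \<in> toeplitz_adj \<Omega> ` l2"
proof -
  obtain g1 g2 where g: "g1 \<in> l2" "g2 \<in> l2" and "u = toeplitz_adj \<Omega> g1" "v = toeplitz_adj \<Omega> g2"
    using assms by blast
  then have "(\<lambda>j. u j - v j) = toeplitz_adj \<Omega> (\<lambda>j. g1 j - g2 j)" by (simp add: toeplitz_adj_diff)
  then show ?thesis using l2_diff[OF g] by blast
qed

end

lemma toeplitz_adj_image_Suc:
  assumes "u \<in> toeplitz_adj \<Omega> ` l2"
  shows "(\<lambda>j. u (Suc j)) \<in> toeplitz_adj \<Omega> ` l2"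
proof -
  obtain g where "g \<in> l2" and u: "u = toeplitz_adj \<Omega> g" using assms by blast
  moreover have "(\<lambda>j. u (Suc j)) = toeplitz_adj \<Omega> (\<lambda>j. g (Suc j))"
    unfolding u toeplitz_adj_def by simp
  ultimately show ?thesis using l2_shift[of g 1] by auto
qed

lemma abs_summable_symbol_taylor_coeff:
  assumes "RH_inf \<Phi>"
  shows "abs_summable_symbol (taylor_coeff \<Phi>)"
proof
  show "summable (\<lambda>k. mnorm (taylor_coeff \<Phi> k))"
    unfolding mnorm_def by (intro summable_sum RH_inf_taylor_coeff_abs_summable assms)
qed

section \<open>Observability operators\<close>

lemma obs_in_l2:
  fixes A :: "complex^'n^'n" and D :: "complex^'n^'r"
  assumes "stable A"
  shows "obs D ((*v) A) x \<in> l2"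
proof -
  have bound: "(norm (obs D ((*v) A) x j))\<^sup>2 \<le> (mnorm D)\<^sup>2 * (norm (((*v) A ^^ j) x))\<^sup>2" for j
    unfolding obs_def power_mult_distrib[symmetric]
    by (intro power_mono norm_matrix_vector_mult_le) simp
  have "summable (\<lambda>j. (mnorm D)\<^sup>2 * (norm (((*v) A ^^ j) x))\<^sup>2)"
    by (rule summable_mult[OF stable_iterate_square_summable[OF assms]])
  then show ?thesis
    unfolding l2_def mem_Collect_eq by (rule summable_comparison_test') (simp add: bound)
qed

lemma obs_diff: "obs D ((*v) A) (x - y) = (\<lambda>j. obs D ((*v) A) x j - obs D ((*v) A) y j)"
proof -
  have "((*v) A ^^ j) (x - y) = ((*v) A ^^ j) x - ((*v) A ^^ j) y" for j
    by (induction j) (simp_all add: matrix_vector_mult_diff_distrib)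
  then show ?thesis unfolding obs_def by (simp add: matrix_vector_mult_diff_distrib)
qed

lemma obs_Suc: "obs D ((*v) A) (A *v x) = (\<lambda>j. obs D ((*v) A) x (Suc j))"
  unfolding obs_def by (simp add: funpow_Suc_right del: funpow.simps)

lemma orth_proj_eq_self:
  assumes "v \<in> X" and diff: "\<And>a b. a \<in> X \<Longrightarrow> b \<in> X \<Longrightarrow> a - b \<in> X"
  shows "orth_proj X v = v"
  unfolding orth_proj_def
proof (rule the_equality)
  show "v \<in> X \<and> (\<forall>z\<in>X. cinner (v - v) z = 0)" using assms(1) by simp
next
  fix y assume "y \<in> X \<and> (\<forall>z\<in>X. cinner (v - y) z = 0)"
  then have "cinner (v - y) (v - y) = 0" using diff assms(1) by blast
  then show "y = v" by (simp add: cinner_self)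
qed

lemma obs_orth_proj_compression:
  fixes A :: "complex^'n^'n"
  assumes inv: "\<And>x. x \<in> X \<Longrightarrow> A *v x \<in> X"
    and diff: "\<And>a b. a \<in> X \<Longrightarrow> b \<in> X \<Longrightarrow> a - b \<in> X"
    and "x \<in> X"
  shows "obs D (\<lambda>y. orth_proj X (A *v y)) x = obs D ((*v) A) x"
proof -
  have "((\<lambda>y. orth_proj X (A *v y)) ^^ j) x = ((*v) A ^^ j) x \<and> ((*v) A ^^ j) x \<in> X" for j
  proof (induction j)
    case (Suc j)
    then have "A *v ((*v) A ^^ j) x \<in> X" by (simp add: inv)
    with Suc show ?case by (simp add: orth_proj_eq_self[OF _ diff])
  qed (simp add: \<open>x \<in> X\<close>)
  then show ?thesis unfolding obs_def by simp
qed

lemma preimage_range_eq_image: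
  assumes "inj_on T S" and "\<And>x. W x \<in> T ` S \<Longrightarrow> W x = T (V x)" and "\<And>x. V x \<in> S"
  shows "{f \<in> S. T f \<in> range W} = V ` {x. W x \<in> T ` S}"
proof (intro set_eqI iffI)
  fix f assume "f \<in> {f \<in> S. T f \<in> range W}"
  then obtain x where f: "f \<in> S" and fx: "T f = W x" by auto
  then have "W x \<in> T ` S" by (metis image_eqI)
  with fx assms(2) have "T f = T (V x)" by simp
  with f assms(1,3) have "f = V x" by (auto dest: inj_onD)
  with \<open>W x \<in> T ` S\<close> show "f \<in> V ` {x. W x \<in> T ` S}" by blast
next
  fix f assume "f \<in> V ` {x. W x \<in> T ` S}"
  then obtain x where "W x \<in> T ` S" and f: "f = V x" by blast
  with assms(2) have "T f = W x" by simp
  with f assms(3) show "f \<in> {f \<in> S. T f \<in> range W}" by auto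
qed

theorem lemma2p3:
  fixes A :: "complex^'n^'n" and C :: "complex^'n^'m" and \<Gamma> :: "complex^'m^'n"
    and R0 :: "complex^'m^'m"
    and \<Phi> :: "complex \<Rightarrow> complex^'m^'r" and C\<Phi> :: "complex^'n^'r"
  defines "R \<equiv> Rfun C A \<Gamma> R0"
    and "T\<Phi>adj \<equiv> l2_adjoint (toeplitz (taylor_coeff \<Phi>))"
    and "Wobs \<equiv> obs C (\<lambda>x. A *v x)"
    and "W\<Phi>obs \<equiv> obs C\<Phi> (\<lambda>x. A *v x)"
  defines "X\<Phi> \<equiv> {x. Wobs x \<in> T\<Phi>adj ` l2}"
  defines "M\<Phi> \<equiv> {f \<in> l2. T\<Phi>adj f \<in> range Wobs}"
  assumes stab: "stable A"
    and nonzero: "\<exists>z. Rdom A z \<and> R z \<noteq> 0"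
    and nonneg: "\<forall>\<zeta>. cmod \<zeta> = 1 \<longrightarrow> psd (R \<zeta>)"
    and outer: "outer_spectral_factor R (Rdom A) \<Phi>"
    and real_C\<Phi>: "\<forall>z. cmod z \<le> 1 \<longrightarrow>
          \<Phi> z = \<Phi> 0 + msc z (C\<Phi> ** matrix_inv (mat 1 - msc z A) ** \<Gamma>)"
    and C\<Phi>_obs: "\<forall>x\<in>X\<Phi>. Wobs x = T\<Phi>adj (W\<Phi>obs x)"
  shows "M\<Phi> = W\<Phi>obs ` X\<Phi> \<and>
         (inj Wobs \<longrightarrow> M\<Phi> = obs C\<Phi> (\<lambda>y. orth_proj X\<Phi> (A *v y)) ` X\<Phi>)"
proof -
  \<comment> \<open>The realization of \<open>R\<close>, its positivity and the realization of \<open>\<Phi>\<close> only serve to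
    construct \<open>C\<Phi>\<close>; here its defining property is the hypothesis \<open>C\<Phi>_obs\<close>.\<close>
  have RH: "RH_inf \<Phi>" and dense: "dense_range_l2 (toeplitz (taylor_coeff \<Phi>))"
    using outer unfolding outer_spectral_factor_def by auto
  interpret abs_summable_symbol "taylor_coeff \<Phi>"
    using RH by (rule abs_summable_symbol_taylor_coeff)
  have adj: "T\<Phi>adj g = toeplitz_adj (taylor_coeff \<Phi>) g" if "g \<in> l2" for g
    unfolding T\<Phi>adj_def using that by (rule l2_adjoint_toeplitz)
  then have adj_image: "T\<Phi>adj ` l2 = toeplitz_adj (taylor_coeff \<Phi>) ` l2"
    by (rule image_cong[OF refl])
  have "inj_on T\<Phi>adj l2"
    using inj_on_toeplitz_adj[OF dense] by (simp only: inj_on_cong[OF adj])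
  then have M: "M\<Phi> = W\<Phi>obs ` X\<Phi>"
    unfolding M\<Phi>_def X\<Phi>_def
  proof (rule preimage_range_eq_image)
    show "Wobs x = T\<Phi>adj (W\<Phi>obs x)" if "Wobs x \<in> T\<Phi>adj ` l2" for x
      using C\<Phi>_obs that unfolding X\<Phi>_def by blast
    show "W\<Phi>obs x \<in> l2" for x
      unfolding W\<Phi>obs_def by (rule obs_in_l2[OF stab])
  qed
  have X_diff: "a - b \<in> X\<Phi>" if "a \<in> X\<Phi>" "b \<in> X\<Phi>" for a b
    using that toeplitz_adj_image_diff unfolding X\<Phi>_def adj_image Wobs_def by (simp add: obs_diff)
  have X_inv: "A *v a \<in> X\<Phi>" if "a \<in> X\<Phi>" for a
    using that toeplitz_adj_image_Suc unfolding X\<Phi>_def adj_image Wobs_def by (simp add: obs_Suc)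
  have "obs C\<Phi> (\<lambda>y. orth_proj X\<Phi> (A *v y)) ` X\<Phi> = W\<Phi>obs ` X\<Phi>"
    unfolding W\<Phi>obs_def by (rule image_cong[OF refl obs_orth_proj_compression[OF X_inv X_diff]])
  with M show ?thesis by simp
qed

end
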